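(* Let $X$ be a bounded metric space and let $A\subset\mathbb{R}$ be an unbounded subset. Then for any positive real numbers $t_1,t_2$, $$d_{GH}\bigl(A\times_{\ell^1}(t_1X),\;A\times_{\ell^1}(t_2X)\bigr)=\frac{|t_1-t_2|}{2}\operatorname{diam}X.$$
   Context: All metric spaces are non-empty. Subsets of $\mathbb{R}$ carry the metric $|x-y|$ induced from $\mathbb{R}$. For metric spaces $X,Y$, $d_{GH}(X,Y)\in[0,\infty]$ is the Gromov--Hausdorff distance: the infimum of the numbers $r\ge 0$ such that there exist a metric space $Z$ and subsets $X',Y'\subset Z$ isometric to $X$ and $Y$ respectively with Hausdorff distance $d_H(X',Y')\le r$ (it may be infinite). Equivalently, $2d_{GH}(X,Y)=\inf\{\operatorname{dis}R\}$ over all correspondences $R\subset X\times Y$ (subsets projecting onto both factors), where $\operatorname{dis}R=\sup\{\,||xx'|-|yy'||:(x,y),(x',y')\in R\}$. For metric spaces $(X,d_X)$, $(Y,d_Y)$, $X\times_{\ell^1}Y$ denotes the Cartesian product with the metric $d((x,y),(x',y'))=d_X(x,x')+d_Y(y,y')$. For $t>0$, $tX$ denotes the metric space $(X,t\,d_X)$. $\operatorname{diam}X=\sup\{d_X(x,x'):x,x'\in X\}$. *)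

theory Defs
  imports "HOL-Analysis.Analysis"
begin

(* The Hausdorff distance is only meaningful for subsets of mspace Z; it is intended for nonempty
   A and B (an infimum over the empty set is top). *)
definition hausdorff_dist :: "'a metric \<Rightarrow> 'a set \<Rightarrow> 'a set \<Rightarrow> ennreal" where
  "hausdorff_dist Z A B =
     max (SUP a\<in>A. INF b\<in>B. ennreal (mdist Z a b)) (SUP b\<in>B. INF a\<in>A. ennreal (mdist Z a b))"

definition isometric_metrics :: "'a metric \<Rightarrow> 'b metric \<Rightarrow> bool" where
  "isometric_metrics X Y \<longleftrightarrow>
     (\<exists>f. bij_betw f (mspace X) (mspace Y) \<and>
          (\<forall>x\<in>mspace X. \<forall>x'\<in>mspace X. mdist Y (f x) (f x') = mdist X x x'))"

(* The ambient space Z ranges over the metric spaces carried by subsets of the type 'a + 'b. This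
   costs no generality: Z may be replaced by its subspace X' \<union> Y', which injects into 'a + 'b.
   Lemma gh_dist_le below makes this precise for ambient spaces of arbitrary type. *)
definition gh_dist :: "'a metric \<Rightarrow> 'b metric \<Rightarrow> ennreal" where
  "gh_dist X Y =
     (INF r \<in> {r::real. 0 \<le> r \<and>
         (\<exists>(Z :: ('a + 'b) metric) X' Y'. X' \<subseteq> mspace Z \<and> Y' \<subseteq> mspace Z \<and>
            isometric_metrics X (submetric Z X') \<and> isometric_metrics Y (submetric Z Y') \<and>
            hausdorff_dist Z X' Y' \<le> ennreal r)}.
      ennreal r)"

definition metric_diam :: "'a metric \<Rightarrow> ennreal" where
  "metric_diam X = (SUP (x, x') \<in> mspace X \<times> mspace X. ennreal (mdist X x x'))"

definition l1_prod_metric :: "'a metric \<Rightarrow> 'b metric \<Rightarrow> ('a \<times> 'b) metric" where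
  "l1_prod_metric X Y =
     metric (mspace X \<times> mspace Y, \<lambda>(x, y) (x', y'). mdist X x x' + mdist Y y y')"

(* Only meaningful for t > 0. *)
definition scale_metric :: "real \<Rightarrow> 'a metric \<Rightarrow> 'a metric" where
  "scale_metric t X = metric (mspace X, \<lambda>x x'. t * mdist X x x')"

lemma Metric_space_l1_prod:
  "Metric_space (mspace X \<times> mspace Y) (\<lambda>(x, y) (x', y'). mdist X x x' + mdist Y y y')"
proof
  fix p q
  show "0 \<le> (\<lambda>(x, y) (x', y'). mdist X x x' + mdist Y y y') p q"
    by (auto split: prod.splits)
  show "(\<lambda>(x, y) (x', y'). mdist X x x' + mdist Y y y') p q =
        (\<lambda>(x, y) (x', y'). mdist X x x' + mdist Y y y') q p"
    by (auto split: prod.splits simp: mdist_commute)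
next
  fix p q assume "p \<in> mspace X \<times> mspace Y" "q \<in> mspace X \<times> mspace Y"
  then show "((\<lambda>(x, y) (x', y'). mdist X x x' + mdist Y y y') p q = 0) = (p = q)"
    by (auto simp: add_nonneg_eq_0_iff)
next
  fix p q r
  assume "p \<in> mspace X \<times> mspace Y" "q \<in> mspace X \<times> mspace Y" "r \<in> mspace X \<times> mspace Y"
  then show "(\<lambda>(x, y) (x', y'). mdist X x x' + mdist Y y y') p r \<le>
        (\<lambda>(x, y) (x', y'). mdist X x x' + mdist Y y y') p q +
        (\<lambda>(x, y) (x', y'). mdist X x x' + mdist Y y y') q r"
    using mdist_triangle[of "fst p" X "fst q" "fst r"] mdist_triangle[of "snd p" Y "snd q" "snd r"]
    by (auto split: prod.splits)
qed

lemma mspace_l1_prod [simp]: "mspace (l1_prod_metric X Y) = mspace X \<times> mspace Y"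
  by (simp add: l1_prod_metric_def Metric_space.mspace_metric[OF Metric_space_l1_prod])

lemma mdist_l1_prod [simp]:
  "mdist (l1_prod_metric X Y) (x, y) (x', y') = mdist X x x' + mdist Y y y'"
  by (simp add: l1_prod_metric_def Metric_space.mdist_metric[OF Metric_space_l1_prod])

lemma Metric_space_scale:
  assumes "t > 0"
  shows "Metric_space (mspace X) (\<lambda>x x'. t * mdist X x x')"
proof
  fix x y z
  assume "x \<in> mspace X" "y \<in> mspace X" "z \<in> mspace X"
  then show "t * mdist X x z \<le> t * mdist X x y + t * mdist X y z"
    using assms mdist_triangle[of x X y z]
    by (metis distrib_left mult_left_mono less_imp_le)
qed (use assms in \<open>auto simp: mdist_commute\<close>)

lemma mspace_scale [simp]: "t > 0 \<Longrightarrow> mspace (scale_metric t X) = mspace X"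
  by (simp add: scale_metric_def Metric_space.mspace_metric[OF Metric_space_scale])

lemma mdist_scale [simp]: "t > 0 \<Longrightarrow> mdist (scale_metric t X) x x' = t * mdist X x x'"
  by (simp add: scale_metric_def Metric_space.mdist_metric[OF Metric_space_scale])

lemma gh_dist_le:
  fixes X :: "'a metric" and Y :: "'b metric" and Z :: "'c metric"
  assumes sub: "X' \<subseteq> mspace Z" "Y' \<subseteq> mspace Z"
    and isoX: "isometric_metrics X (submetric Z X')"
    and isoY: "isometric_metrics Y (submetric Z Y')"
    and "0 \<le> r" and haus: "hausdorff_dist Z X' Y' \<le> ennreal r"
  shows "gh_dist X Y \<le> ennreal r"
proof -
  obtain f where f: "bij_betw f (mspace X) X'"
    "\<And>x x'. x \<in> mspace X \<Longrightarrow> x' \<in> mspace X \<Longrightarrow> mdist Z (f x) (f x') = mdist X x x'"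
    using isoX sub unfolding isometric_metrics_def by (auto simp: Int_absorb2)
  obtain g where g: "bij_betw g (mspace Y) Y'"
    "\<And>y y'. y \<in> mspace Y \<Longrightarrow> y' \<in> mspace Y \<Longrightarrow> mdist Z (g y) (g y') = mdist Y y y'"
    using isoY sub unfolding isometric_metrics_def by (auto simp: Int_absorb2)
  define U where "U = X' \<union> Y'"
  have U: "U \<subseteq> mspace Z" using sub by (auto simp: U_def)
  define h where "h z = (if z \<in> X' then Inl (inv_into (mspace X) f z)
                         else Inr (inv_into (mspace Y) g z) :: 'a + 'b)" for z
  have h: "inj_on h U"
  proof (rule inj_onI)
    fix z z' assume z: "z \<in> U" "z' \<in> U" and eq: "h z = h z'"
    have imgs: "f ` mspace X = X'" "g ` mspace Y = Y'"
      using f(1) g(1) by (auto simp: bij_betw_def)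
    show "z = z'"
    proof (cases "z \<in> X'")
      case True
      with eq have "z' \<in> X'" "inv_into (mspace X) f z = inv_into (mspace X) f z'"
        by (auto simp: h_def split: if_splits)
      with True imgs show ?thesis by (metis inv_into_injective)
    next
      case False
      with eq have "z' \<notin> X'" "inv_into (mspace Y) g z = inv_into (mspace Y) g z'"
        by (auto simp: h_def split: if_splits)
      with False z imgs show ?thesis unfolding U_def by (metis UnE inv_into_injective)
    qed
  qed
  define k where "k = inv_into U h"
  have kh: "k (h z) = z" if "z \<in> U" for z
    using h that by (simp add: k_def)
  define d where "d w w' = mdist Z (k w) (k w')" for w w'
  have "Metric_space (h ` U) d"
  proof
    fix x y z assume "x \<in> h ` U" "y \<in> h ` U" "z \<in> h ` U"
    then show "d x z \<le> d x y + d y z"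
      using U by (auto simp: d_def kh intro!: mdist_triangle)
  next
    fix x y assume "x \<in> h ` U" "y \<in> h ` U"
    then show "(d x y = 0) = (x = y)"
      using U by (auto simp: d_def kh subset_iff)
  qed (auto simp: d_def mdist_commute)
  then interpret W: Metric_space "h ` U" d .
  define W where "W = metric (h ` U, d)"
  have mW: "mspace W = h ` U" and dW: "mdist W = d" by (auto simp: W_def)
  have dd: "mdist W (h z) (h z') = mdist Z z z'" if "z \<in> U" "z' \<in> U" for z z'
    using that by (simp add: dW d_def kh)
  have X'U: "X' \<subseteq> U" and Y'U: "Y' \<subseteq> U" by (auto simp: U_def)
  have imgX: "h ` X' \<inter> mspace W = h ` X'" and imgY: "h ` Y' \<inter> mspace W = h ` Y'"
    using X'U Y'U by (auto simp: mW)
  have iX: "isometric_metrics X (submetric W (h ` X'))"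
    unfolding isometric_metrics_def
  proof (intro exI conjI ballI)
    show "bij_betw (h \<circ> f) (mspace X) (mspace (submetric W (h ` X')))"
      using bij_betw_trans[OF f(1) inj_on_imp_bij_betw[OF inj_on_subset[OF h X'U]]]
      by (simp add: imgX)
    fix x x' assume "x \<in> mspace X" "x' \<in> mspace X"
    moreover from this have "f x \<in> U" "f x' \<in> U"
      using f(1) X'U by (auto simp: bij_betw_def)
    ultimately show "mdist (submetric W (h ` X')) ((h \<circ> f) x) ((h \<circ> f) x') = mdist X x x'"
      by (simp add: dd f(2))
  qed
  have iY: "isometric_metrics Y (submetric W (h ` Y'))"
    unfolding isometric_metrics_def
  proof (intro exI conjI ballI)
    show "bij_betw (h \<circ> g) (mspace Y) (mspace (submetric W (h ` Y')))"
      using bij_betw_trans[OF g(1) inj_on_imp_bij_betw[OF inj_on_subset[OF h Y'U]]]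
      by (simp add: imgY)
    fix y y' assume "y \<in> mspace Y" "y' \<in> mspace Y"
    moreover from this have "g y \<in> U" "g y' \<in> U"
      using g(1) Y'U by (auto simp: bij_betw_def)
    ultimately show "mdist (submetric W (h ` Y')) ((h \<circ> g) y) ((h \<circ> g) y') = mdist Y y y'"
      by (simp add: dd g(2))
  qed
  have "(INF b\<in>Y'. ennreal (mdist W (h a) (h b))) = (INF b\<in>Y'. ennreal (mdist Z a b))"
    if "a \<in> X'" for a
    using that X'U Y'U by (intro INF_cong refl) (auto simp: dd subset_iff)
  moreover have "(INF a\<in>X'. ennreal (mdist W (h a) (h b))) = (INF a\<in>X'. ennreal (mdist Z a b))"
    if "b \<in> Y'" for b
    using that X'U Y'U by (intro INF_cong refl) (auto simp: dd subset_iff)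
  ultimately have "hausdorff_dist W (h ` X') (h ` Y') = hausdorff_dist Z X' Y'"
    by (simp add: hausdorff_dist_def image_image)
  then have "hausdorff_dist W (h ` X') (h ` Y') \<le> ennreal r" using haus by simp
  with iX iY \<open>0 \<le> r\<close> imgX imgY show ?thesis
    unfolding gh_dist_def by (intro INF_lower) blast
qed

end

theory Submission
  imports Defs
begin

text \<open>
  Write \<open>t\<^sub>2 \<le> t\<^sub>1\<close> and \<open>D\<close> for the diameter of \<open>X\<close>.

  Upper bound. The two products have the same points, and passing from the \<open>t\<^sub>2\<close>-metric to the
  \<open>t\<^sub>1\<close>-metric increases every distance by at most \<open>(t\<^sub>1 - t\<^sub>2) D\<close>. Two metrics on one set that
  differ by at most \<open>2 \<rho>\<close> can be glued along a bridge of length \<open>\<rho>\<close> between the two copies of each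
  point (\<open>gh_dist_le_of_dist_between\<close>).

  Lower bound. A Hausdorff distance below \<open>r\<close> gives a map \<open>f\<close> of distortion at most \<open>\<delta> = 2 r\<close>
  from \<open>A \<times> t\<^sub>1 X\<close> to \<open>A \<times> t\<^sub>2 X\<close>. For given \<open>x, x'\<close> consider a zigzag whose \<open>n\<close>-th point is
  \<open>(a\<^sub>n, x)\<close> or \<open>(a\<^sub>n, x')\<close> according to the parity of \<open>n\<close>, where \<open>a\<^sub>n\<close> is a monotone sequence in
  \<open>A\<close> with large gaps. Each of its steps is longer by \<open>t\<^sub>1 d(x, x')\<close> than its shadow on the line,
  whereas in the image a step exceeds its shadow by at most \<open>t\<^sub>2 D\<close>; on both sides the lengths of the
  shadows add up to the distance of the end points, because the gaps are so large that \<open>f\<close> cannot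
  disturb the order of the first coordinates. The distance between the end points of the zigzag is
  distorted by an amount independent of \<open>n\<close>, so comparing both sides
  gives \<open>n (t\<^sub>1 d(x, x') - t\<^sub>2 D - \<delta>) \<le> C\<close> for every \<open>n\<close>, hence \<open>t\<^sub>1 d(x, x') \<le> t\<^sub>2 D + \<delta>\<close>
  (\<open>line_product_distortion\<close>). A single pair of points would lose a bounded additive constant; letting
  the number of steps tend to infinity removes it.
\<close>

section \<open>Gromov--Hausdorff distance\<close>

lemma hausdorff_dist_commute: "hausdorff_dist Z A B = hausdorff_dist Z B A"
  by (simp add: hausdorff_dist_def mdist_commute max.commute)

lemma gh_dist_commute_le: "gh_dist Y X \<le> gh_dist X Y"
  unfolding gh_dist_def[of X Y]
proof (rule INF_greatest, clarify)
  fix r :: real and Z X' Y'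
  assume "0 \<le> r" "X' \<subseteq> mspace Z" "Y' \<subseteq> mspace Z"
    "isometric_metrics X (submetric Z X')" "isometric_metrics Y (submetric Z Y')"
    "hausdorff_dist Z X' Y' \<le> ennreal r"
  then show "gh_dist Y X \<le> ennreal r"
    by (intro gh_dist_le[of Y' Z X']) (simp_all add: hausdorff_dist_commute)
qed

lemma gh_dist_commute: "gh_dist X Y = gh_dist Y X"
  by (intro antisym gh_dist_commute_le)

text \<open>
  The distance between points on different copies is \<open>\<rho>\<close> plus the smaller of the two metrics: with
  the smaller metric, a detour inside either copy does not shorten the bridge, and the upper
  bound \<open>2 * \<rho>\<close> on the difference says that crossing the bridge twice is no shortcut.
\<close>
lemma gh_dist_le_of_dist_between:
  fixes P Q :: "'a metric"
  assumes M: "mspace P = M" "mspace Q = M"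
    and "\<rho> > 0"
    and lower: "\<And>x y. x \<in> M \<Longrightarrow> y \<in> M \<Longrightarrow> mdist P x y \<le> mdist Q x y"
    and upper: "\<And>x y. x \<in> M \<Longrightarrow> y \<in> M \<Longrightarrow> mdist Q x y \<le> mdist P x y + 2 * \<rho>"
  shows "gh_dist P Q \<le> ennreal \<rho>"
proof -
  define d where "d = (\<lambda>(x, i) (y, j). if i \<and> j then mdist P x y
      else if \<not> i \<and> \<not> j then mdist Q x y else \<rho> + mdist P x y)"
  have ms: "Metric_space (M \<times> (UNIV :: bool set)) d"
  proof
    fix u v
    show "0 \<le> d u v" "d u v = d v u"
      using \<open>\<rho> > 0\<close> by (auto simp: d_def mdist_commute split: prod.splits)
  next
    fix u v assume "u \<in> M \<times> (UNIV :: bool set)" "v \<in> M \<times> (UNIV :: bool set)"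
    moreover obtain x i y j where [simp]: "u = (x, i)" "v = (y, j)"
      by (metis surj_pair)
    moreover have "\<rho> + mdist P x y \<noteq> 0"
      using \<open>\<rho> > 0\<close> mdist_nonneg[of P x y] by linarith
    ultimately show "d u v = 0 \<longleftrightarrow> u = v"
      using M by (cases i; cases j) (simp_all add: d_def)
  next
    fix u v w
    assume mem: "u \<in> M \<times> (UNIV :: bool set)" "v \<in> M \<times> (UNIV :: bool set)"
      "w \<in> M \<times> (UNIV :: bool set)"
    obtain x i y j z k where [simp]: "u = (x, i)" "v = (y, j)" "w = (z, k)"
      by (metis surj_pair)
    have xyz: "x \<in> M" "y \<in> M" "z \<in> M" using mem by auto
    have "mdist P x z \<le> mdist P x y + mdist P y z" "mdist Q x z \<le> mdist Q x y + mdist Q y z"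
      using xyz M mdist_triangle by metis+
    then show "d u w \<le> d u v + d v w"
      using lower[OF xyz(1,2)] lower[OF xyz(2,3)] upper[OF xyz(1,3)] \<open>\<rho> > 0\<close>
      by (cases i; cases j; cases k) (simp_all add: d_def)
  qed
  then interpret Metric_space "M \<times> (UNIV :: bool set)" d .
  define Z where "Z = metric (M \<times> (UNIV :: bool set), d)"
  have Z [simp]: "mspace Z = M \<times> UNIV" "mdist Z = d"
    by (simp_all add: Z_def)
  have copy: "bij_betw (\<lambda>x. (x, i)) M (M \<times> {i})" for i :: bool
    by (auto simp: bij_betw_def inj_on_def)
  have P: "isometric_metrics P (submetric Z (M \<times> {True}))"
    unfolding isometric_metrics_def
    by (rule exI[of _ "\<lambda>x. (x, True)"]) (use copy M in \<open>auto simp: d_def Times_Int_Times\<close>)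
  have Q: "isometric_metrics Q (submetric Z (M \<times> {False}))"
    unfolding isometric_metrics_def
    by (rule exI[of _ "\<lambda>x. (x, False)"]) (use copy M in \<open>auto simp: d_def Times_Int_Times\<close>)
  have bridge: "d (x, True) (x, False) = \<rho>" if "x \<in> M" for x
    using that M by (simp add: d_def)
  have "hausdorff_dist Z (M \<times> {True}) (M \<times> {False}) \<le> ennreal \<rho>"
    unfolding hausdorff_dist_def
  proof (intro max.boundedI SUP_least)
    fix u assume "u \<in> M \<times> {True}"
    then show "(INF v\<in>M \<times> {False}. ennreal (mdist Z u v)) \<le> ennreal \<rho>"
      by (intro INF_lower2[of "(fst u, False)"]) (auto simp: bridge)
  next
    fix v assume "v \<in> M \<times> {False}"
    then show "(INF u\<in>M \<times> {True}. ennreal (mdist Z u v)) \<le> ennreal \<rho>"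
      by (intro INF_lower2[of "(fst v, True)"]) (auto simp: bridge)
  qed
  then show ?thesis
    using P Q \<open>\<rho> > 0\<close> by (intro gh_dist_le[of "M \<times> {True}" Z "M \<times> {False}"]) auto
qed

text \<open>
  Moving every point of one subset to a point at distance less than \<open>r'\<close> in the other changes a
  distance by at most \<open>2 * r'\<close>; the strict inequality \<open>r < r'\<close> provides these points although
  the infimum in the Hausdorff distance need not be attained.
\<close>
lemma small_distortion_map:
  assumes sub: "X' \<subseteq> mspace Z" "Y' \<subseteq> mspace Z"
    and isoX: "isometric_metrics X (submetric Z X')"
    and isoY: "isometric_metrics Y (submetric Z Y')"
    and haus: "hausdorff_dist Z X' Y' \<le> ennreal r" and "0 \<le> r" "r < r'"
  obtains f where "f \<in> mspace X \<rightarrow> mspace Y"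
    and "\<And>x x'. x \<in> mspace X \<Longrightarrow> x' \<in> mspace X \<Longrightarrow>
           \<bar>mdist Y (f x) (f x') - mdist X x x'\<bar> \<le> 2 * r'"
proof -
  obtain g where g: "bij_betw g (mspace X) X'"
    "\<And>x x'. x \<in> mspace X \<Longrightarrow> x' \<in> mspace X \<Longrightarrow> mdist Z (g x) (g x') = mdist X x x'"
    using isoX sub unfolding isometric_metrics_def by (auto simp: Int_absorb2)
  obtain h where h: "bij_betw h (mspace Y) Y'"
    "\<And>y y'. y \<in> mspace Y \<Longrightarrow> y' \<in> mspace Y \<Longrightarrow> mdist Z (h y) (h y') = mdist Y y y'"
    using isoY sub unfolding isometric_metrics_def by (auto simp: Int_absorb2)
  have "\<exists>y \<in> mspace Y. mdist Z (g x) (h y) < r'" if x: "x \<in> mspace X" for x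
  proof -
    have "g x \<in> X'" using x g(1) by (auto simp: bij_betw_def)
    then have "(INF b\<in>Y'. ennreal (mdist Z (g x) b)) \<le> hausdorff_dist Z X' Y'"
      unfolding hausdorff_dist_def by (intro max.coboundedI1 SUP_upper)
    also have "\<dots> < ennreal r'"
      using haus \<open>0 \<le> r\<close> \<open>r < r'\<close> by (meson ennreal_lessI le_less_trans order.strict_trans1)
    finally obtain b where b: "b \<in> Y'" "ennreal (mdist Z (g x) b) < ennreal r'"
      by (auto simp: INF_less_iff)
    then show ?thesis
      using h(1) by (auto simp: bij_betw_def ennreal_less_iff)
  qed
  then obtain f where f: "\<And>x. x \<in> mspace X \<Longrightarrow> f x \<in> mspace Y"
    "\<And>x. x \<in> mspace X \<Longrightarrow> mdist Z (g x) (h (f x)) < r'"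
    by metis
  show ?thesis
  proof (rule that)
    show "f \<in> mspace X \<rightarrow> mspace Y" using f(1) by blast
    fix x x' assume x: "x \<in> mspace X" "x' \<in> mspace X"
    define p q p' q' where "p = g x" "q = g x'" "p' = h (f x)" "q' = h (f x')"
    have mem: "p \<in> mspace Z" "q \<in> mspace Z" "p' \<in> mspace Z" "q' \<in> mspace Z"
      using x f(1) g(1) h(1) sub by (auto simp: p_q_p'_q'_def bij_betw_def)
    have "mdist Z p q \<le> mdist Z p p' + mdist Z p' q" "mdist Z p' q \<le> mdist Z p' q' + mdist Z q' q"
      "mdist Z p' q' \<le> mdist Z p' p + mdist Z p q'" "mdist Z p q' \<le> mdist Z p q + mdist Z q q'"
      using mem by (auto intro: mdist_triangle)
    moreover have "mdist Z p p' < r'" "mdist Z q q' < r'"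
      using f(2) x by (auto simp: p_q_p'_q'_def)
    moreover have "mdist Z p q = mdist X x x'" "mdist Z p' q' = mdist Y (f x) (f x')"
      using x f(1) g(2) h(2) by (auto simp: p_q_p'_q'_def)
    ultimately show "\<bar>mdist Y (f x) (f x') - mdist X x x'\<bar> \<le> 2 * r'"
      by (simp add: mdist_commute)
  qed
qed

section \<open>Almost isometric maps between products with subsets of the line\<close>

text \<open>
  Monotonicity of the sequence is expressed by the additivity of its distances, so that
  increasing and decreasing sequences need not be told apart later.
\<close>
lemma unbounded_real_sparse_sequence:
  fixes A :: "real set" and L :: real
  assumes "\<not> bounded A" "0 \<le> L"
  obtains a where "\<And>n. a n \<in> A"
    and "\<And>n. \<bar>a (Suc n) - a 0\<bar> = \<bar>a (Suc n) - a n\<bar> + \<bar>a n - a 0\<bar>"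
    and "\<And>n. L \<le> \<bar>a (Suc n) - a n\<bar>"
proof -
  have "\<exists>s \<in> {1, -1 :: real}. \<forall>M. \<exists>a \<in> A. M \<le> s * a"
  proof (rule ccontr)
    assume "\<not> ?thesis"
    then obtain M M' where "\<forall>a\<in>A. a < M" "\<forall>a\<in>A. - a < M'"
      by (auto simp: not_le)
    then have "A \<subseteq> {- M' .. M}" by force
    then show False using \<open>\<not> bounded A\<close> bounded_closed_interval bounded_subset by blast
  qed
  then obtain s where s: "s = 1 \<or> s = -1" and unb: "\<And>M. \<exists>a \<in> A. M \<le> s * a"
    by blast
  have "\<exists>a. \<forall>n. a n \<in> A \<and> s * a n + L \<le> s * a (Suc n)"
    by (rule dependent_nat_choice) (use unb in blast)+
  then obtain a where a: "\<And>n. a n \<in> A" "\<And>n. s * a n + L \<le> s * a (Suc n)"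
    by blast
  have mono: "s * a 0 \<le> s * a n" for n
  proof (induction n)
    case (Suc n)
    then show ?case using a(2)[of n] \<open>0 \<le> L\<close> by linarith
  qed simp
  show ?thesis
  proof (rule that)
    fix n
    show "\<bar>a (Suc n) - a 0\<bar> = \<bar>a (Suc n) - a n\<bar> + \<bar>a n - a 0\<bar>"
      using s a(2)[of n] mono[of n] \<open>0 \<le> L\<close> by auto
    show "L \<le> \<bar>a (Suc n) - a n\<bar>"
      using s a(2)[of n] \<open>0 \<le> L\<close> by auto
  qed (rule a)
qed

text \<open>
  One of \<open>b0, b1, b2\<close> lies between the other two. If it were \<open>b0\<close>, then \<open>\<bar>b2 - b1\<bar>\<close> would be the
  sum of the other two distances and hence exceed \<open>\<bar>a2 - a1\<bar>\<close> by at least \<open>2 * \<bar>a1 - a0\<bar> - 2 * C\<close>,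
  which is more than the permitted \<open>C\<close>; similarly for \<open>b2\<close>.
\<close>
lemma between_of_approx_between:
  fixes a0 a1 a2 b0 b1 b2 C :: real
  assumes "\<bar>a2 - a0\<bar> = \<bar>a2 - a1\<bar> + \<bar>a1 - a0\<bar>"
    and "2 * C < \<bar>a2 - a1\<bar>" "2 * C < \<bar>a1 - a0\<bar>"
    and "\<bar>\<bar>b1 - b0\<bar> - \<bar>a1 - a0\<bar>\<bar> \<le> C" "\<bar>\<bar>b2 - b0\<bar> - \<bar>a2 - a0\<bar>\<bar> \<le> C"
    and "\<bar>\<bar>b2 - b1\<bar> - \<bar>a2 - a1\<bar>\<bar> \<le> C"
  shows "\<bar>b2 - b0\<bar> = \<bar>b2 - b1\<bar> + \<bar>b1 - b0\<bar>"
  using assms by argo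

text \<open>
  The zigzag argument. The bound \<open>D\<close> on the source fibre is absent from the conclusion because it
  enters only through the constant \<open>C\<close>, which does not grow with the length of the zigzag, whereas
  \<open>E\<close> and \<open>\<delta>\<close> are paid at every step.
\<close>
lemma line_product_distortion:
  fixes X :: "'a metric" and Y :: "'b metric" and A B :: "real set"
  assumes "\<not> bounded A"
    and D: "\<And>x x'. x \<in> mspace X \<Longrightarrow> x' \<in> mspace X \<Longrightarrow> mdist X x x' \<le> D"
    and E: "\<And>y y'. y \<in> mspace Y \<Longrightarrow> y' \<in> mspace Y \<Longrightarrow> mdist Y y y' \<le> E"
    and f: "f \<in> A \<times> mspace X \<rightarrow> B \<times> mspace Y"
    and dis: "\<And>p q. p \<in> A \<times> mspace X \<Longrightarrow> q \<in> A \<times> mspace X \<Longrightarrow>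
       \<bar>mdist (l1_prod_metric (submetric euclidean_metric B) Y) (f p) (f q)
         - mdist (l1_prod_metric (submetric euclidean_metric A) X) p q\<bar> \<le> \<delta>"
    and x: "x \<in> mspace X" "x' \<in> mspace X"
  shows "mdist X x x' \<le> E + \<delta>"
proof -
  define C where "C = \<delta> + D + E"
  obtain a0 where a0: "a0 \<in> A" using \<open>\<not> bounded A\<close> by fastforce
  have "0 \<le> \<delta>" using dis[of "(a0, x)" "(a0, x)"] a0 x by auto
  moreover have "0 \<le> D" using order_trans[OF mdist_nonneg D[OF x]] .
  moreover have "0 \<le> E"
    using order_trans[OF mdist_nonneg E[of "snd (f (a0, x))" "snd (f (a0, x))"]] f a0 x
    by (auto simp: Pi_iff mem_Times_iff)
  ultimately have "0 \<le> C" by (simp add: C_def)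
  obtain a where a: "\<And>n. a n \<in> A"
    and add_a: "\<And>n. \<bar>a (Suc n) - a 0\<bar> = \<bar>a (Suc n) - a n\<bar> + \<bar>a n - a 0\<bar>"
    and gap: "\<And>n. 2 * C + 1 \<le> \<bar>a (Suc n) - a n\<bar>"
    by (rule unbounded_real_sparse_sequence[OF \<open>\<not> bounded A\<close>, of "2 * C + 1"])
      (use \<open>0 \<le> C\<close> in auto)
  define w where "w n = (if even n then x else x')" for n :: nat
  have w: "w n \<in> mspace X" for n using x by (simp add: w_def)
  define b where "b n = fst (f (a n, w n))" for n
  define y where "y n = snd (f (a n, w n))" for n
  have fy: "f (a n, w n) = (b n, y n)" and y: "y n \<in> mspace Y" for n
    using f a w by (auto simp: b_def y_def Pi_iff mem_Times_iff)
  have approx: "\<bar>(\<bar>b m - b n\<bar> + mdist Y (y m) (y n)) - (\<bar>a m - a n\<bar> + mdist X (w m) (w n))\<bar> \<le> \<delta>"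
    for m n
    using dis[of "(a m, w m)" "(a n, w n)"] a w by (simp add: fy dist_real_def)
  have coarse: "\<bar>\<bar>b m - b n\<bar> - \<bar>a m - a n\<bar>\<bar> \<le> C" for m n
  proof -
    have "0 \<le> mdist X (w m) (w n)" "mdist X (w m) (w n) \<le> D"
      "0 \<le> mdist Y (y m) (y n)" "mdist Y (y m) (y n) \<le> E"
      using D E w y by auto
    then show ?thesis using approx[of m n] unfolding C_def by linarith
  qed
  have add_b: "\<bar>b (Suc n) - b 0\<bar> = \<bar>b (Suc n) - b n\<bar> + \<bar>b n - b 0\<bar>" for n
  proof (cases n)
    case (Suc k)
    have "2 * C < \<bar>a n - a 0\<bar>"
      using gap[of k] add_a[of k] Suc by simp
    moreover have "2 * C < \<bar>a (Suc n) - a n\<bar>"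
      using gap[of n] by simp
    ultimately show ?thesis
      by (rule between_of_approx_between[OF add_a _ _ coarse coarse coarse, rotated])
  qed simp
  have zigzag: "\<bar>a n - a 0\<bar> + real n * mdist X x x' \<le> \<bar>b n - b 0\<bar> + real n * (E + \<delta>)" for n
  proof (induction n)
    case (Suc n)
    have "mdist X (w (Suc n)) (w n) = mdist X x x'"
      by (simp add: w_def mdist_commute)
    then have "\<bar>a (Suc n) - a n\<bar> + mdist X x x' \<le> \<bar>b (Suc n) - b n\<bar> + E + \<delta>"
      using approx[of "Suc n" n] E[OF y[of "Suc n"] y[of n]] by linarith
    then show ?case
      using Suc add_a[of n] add_b[of n] by (simp add: algebra_simps)
  qed simp
  have bounded_excess: "real n * (mdist X x x' - (E + \<delta>)) \<le> C" for n
    using zigzag[of n] coarse[of n 0] by (simp add: algebra_simps)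
  show ?thesis
  proof (rule ccontr)
    assume "\<not> ?thesis"
    then obtain n where "C < real n * (mdist X x x' - (E + \<delta>))"
      using reals_Archimedean3[of "mdist X x x' - (E + \<delta>)"] by auto
    then show False using bounded_excess[of n] by simp
  qed
qed

section \<open>The distance between two rescalings\<close>

lemma metric_diam_eq_ennreal:
  assumes "mspace X \<noteq> {}" and "Metric_space.mbounded (mspace X) (mdist X) (mspace X)"
  obtains D where "0 \<le> D" and "metric_diam X = ennreal D"
    and "\<And>x x'. x \<in> mspace X \<Longrightarrow> x' \<in> mspace X \<Longrightarrow> mdist X x x' \<le> D"
    and "\<And>c. (\<And>x x'. x \<in> mspace X \<Longrightarrow> x' \<in> mspace X \<Longrightarrow> mdist X x x' \<le> c) \<Longrightarrow> D \<le> c"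
proof -
  interpret Metric_space "mspace X" "mdist X" by simp
  obtain K where K: "\<And>x x'. x \<in> mspace X \<Longrightarrow> x' \<in> mspace X \<Longrightarrow> mdist X x x' \<le> K"
    using assms(2) by (auto simp: mbounded_alt)
  have least: "metric_diam X \<le> ennreal c"
    if "\<And>x x'. x \<in> mspace X \<Longrightarrow> x' \<in> mspace X \<Longrightarrow> mdist X x x' \<le> c" for c
    unfolding metric_diam_def using that by (auto intro!: SUP_least ennreal_leI)
  define D where "D = enn2real (metric_diam X)"
  have D: "metric_diam X = ennreal D"
    using le_less_trans[OF least[OF K] ennreal_less_top] by (simp add: D_def)
  show ?thesis
  proof (rule that[OF _ D])
    show "0 \<le> D" by (simp add: D_def)
    show "mdist X x x' \<le> D" if "x \<in> mspace X" "x' \<in> mspace X" for x x'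
    proof -
      have "ennreal (mdist X x x') \<le> metric_diam X"
        unfolding metric_diam_def using that by (intro SUP_upper2[of "(x, x')"]) auto
      then show ?thesis using D \<open>0 \<le> D\<close> by (simp add: ennreal_le_iff)
    qed
    fix c assume c: "\<And>x x'. x \<in> mspace X \<Longrightarrow> x' \<in> mspace X \<Longrightarrow> mdist X x x' \<le> c"
    have "0 \<le> c" using c assms(1) by (metis all_not_in_conv mdist_nonneg order_trans)
    then show "D \<le> c" using least[OF c] D by (simp add: ennreal_le_iff)
  qed
qed

lemma gh_dist_rescaled_fibres_ordered:
  fixes X :: "'a metric" and A :: "real set" and s t :: real
  assumes "mspace X \<noteq> {}"
    and "Metric_space.mbounded (mspace X) (mdist X) (mspace X)"
    and "\<not> bounded A" and "0 < s" and "s \<le> t"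
  shows "gh_dist (l1_prod_metric (submetric euclidean_metric A) (scale_metric s X))
                 (l1_prod_metric (submetric euclidean_metric A) (scale_metric t X))
         = ennreal ((t - s) / 2) * metric_diam X"
proof -
  let ?P = "l1_prod_metric (submetric euclidean_metric A) (scale_metric s X)"
  let ?Q = "l1_prod_metric (submetric euclidean_metric A) (scale_metric t X)"
  have "0 < t" using assms by simp
  obtain D where D: "0 \<le> D" "metric_diam X = ennreal D"
    and dist_le: "\<And>x x'. x \<in> mspace X \<Longrightarrow> x' \<in> mspace X \<Longrightarrow> mdist X x x' \<le> D"
    and least: "\<And>c. (\<And>x x'. x \<in> mspace X \<Longrightarrow> x' \<in> mspace X \<Longrightarrow> mdist X x x' \<le> c) \<Longrightarrow> D \<le> c"
    using metric_diam_eq_ennreal[OF assms(1,2)] by blast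
  define R where "R = (t - s) / 2 * D"
  have "0 \<le> R" using D \<open>s \<le> t\<close> by (simp add: R_def)
  have "gh_dist ?P ?Q \<le> ennreal R"
  proof (rule ennreal_le_epsilon)
    fix e :: real assume "0 < e"
    have "gh_dist ?P ?Q \<le> ennreal (R + e)"
    proof (rule gh_dist_le_of_dist_between[where M = "A \<times> mspace X"])
      show "0 < R + e" using \<open>0 < e\<close> \<open>0 \<le> R\<close> by simp
      fix p q assume pq: "p \<in> A \<times> mspace X" "q \<in> A \<times> mspace X"
      obtain a x a' x' where [simp]: "p = (a, x)" "q = (a', x')" by (metis surj_pair)
      have "s * mdist X x x' \<le> t * mdist X x x'"
        using \<open>s \<le> t\<close> by (simp add: mult_right_mono)
      then show "mdist ?P p q \<le> mdist ?Q p q"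
        using \<open>0 < s\<close> \<open>0 < t\<close> by simp
      have "(t - s) * mdist X x x' \<le> (t - s) * D"
        using pq \<open>s \<le> t\<close> dist_le by (simp add: mult_left_mono)
      then show "mdist ?Q p q \<le> mdist ?P p q + 2 * (R + e)"
        using \<open>0 < s\<close> \<open>0 < t\<close> \<open>0 < e\<close> by (simp add: R_def field_simps)
    qed (use \<open>0 < s\<close> \<open>0 < t\<close> in auto)
    then show "gh_dist ?P ?Q \<le> ennreal R + ennreal e"
      using \<open>0 < e\<close> \<open>0 \<le> R\<close> by simp
  qed
  moreover have "ennreal R \<le> gh_dist ?P ?Q"
    unfolding gh_dist_def
  proof (rule INF_greatest, clarify)
    fix r :: real and Z :: "((real \<times> 'a) + (real \<times> 'a)) metric" and P' Q'
    assume r: "0 \<le> r" and sub: "P' \<subseteq> mspace Z" "Q' \<subseteq> mspace Z"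
      and iso: "isometric_metrics ?P (submetric Z P')" "isometric_metrics ?Q (submetric Z Q')"
      and haus: "hausdorff_dist Z P' Q' \<le> ennreal r"
    have "R \<le> r'" if r': "r < r'" for r'
    proof -
      \<comment> \<open>The map must go from the larger fibres to the smaller ones: the zigzag argument bounds
        the fibres of its source.\<close>
      have "hausdorff_dist Z Q' P' \<le> ennreal r"
        using haus by (simp add: hausdorff_dist_commute)
      then obtain f where f: "f \<in> mspace ?Q \<rightarrow> mspace ?P"
        "\<And>p q. p \<in> mspace ?Q \<Longrightarrow> q \<in> mspace ?Q \<Longrightarrow>
           \<bar>mdist ?P (f p) (f q) - mdist ?Q p q\<bar> \<le> 2 * r'"
        using small_distortion_map[OF sub(2,1) iso(2,1) _ r r'] by blast
      have "mdist X x x' \<le> (s * D + 2 * r') / t" if x: "x \<in> mspace X" "x' \<in> mspace X" for x x'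
      proof -
        have "mdist (scale_metric t X) x x' \<le> s * D + 2 * r'"
        proof (rule line_product_distortion[OF \<open>\<not> bounded A\<close>, where D = "t * D" and f = f and B = A])
          show "f \<in> A \<times> mspace (scale_metric t X) \<rightarrow> A \<times> mspace (scale_metric s X)"
            using f(1) by simp
          show "\<bar>mdist ?P (f p) (f q) - mdist ?Q p q\<bar> \<le> 2 * r'"
            if "p \<in> A \<times> mspace (scale_metric t X)" "q \<in> A \<times> mspace (scale_metric t X)" for p q
            using f(2)[of p q] that by simp
        qed (use x dist_le \<open>0 < s\<close> \<open>0 < t\<close> in auto)
        then show ?thesis using \<open>0 < t\<close> by (simp add: field_simps)
      qed
      then have "D \<le> (s * D + 2 * r') / t" by (rule least)
      then show "R \<le> r'" using \<open>0 < t\<close> by (simp add: R_def field_simps)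
    qed
    then have "R \<le> r" by (rule dense_ge)
    then show "ennreal R \<le> ennreal r" by (rule ennreal_leI)
  qed
  ultimately have "gh_dist ?P ?Q = ennreal R" by (rule antisym)
  also have "\<dots> = ennreal ((t - s) / 2) * metric_diam X"
    unfolding R_def D(2) using D(1) \<open>s \<le> t\<close> by (intro ennreal_mult) simp_all
  finally show ?thesis .
qed

theorem corollary2:
  fixes X :: "'a metric" and A :: "real set" and t1 t2 :: real
  assumes "mspace X \<noteq> {}"
    and "Metric_space.mbounded (mspace X) (mdist X) (mspace X)"
    and "\<not> bounded A"
    and "t1 > 0" and "t2 > 0"
  shows "gh_dist (l1_prod_metric (submetric euclidean_metric A) (scale_metric t1 X))
                 (l1_prod_metric (submetric euclidean_metric A) (scale_metric t2 X))
         = ennreal (\<bar>t1 - t2\<bar> / 2) * metric_diam X"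
proof (cases "t1 \<le> t2")
  case True
  then show ?thesis
    using gh_dist_rescaled_fibres_ordered[OF assms(1-3) \<open>t1 > 0\<close> True] by (simp add: abs_if)
next
  case False
  then show ?thesis
    using gh_dist_rescaled_fibres_ordered[OF assms(1-3) \<open>t2 > 0\<close>, of t1]
    by (simp add: abs_if gh_dist_commute[of _ "l1_prod_metric _ (scale_metric t2 X)"])
qed

end
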